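(* Let $b\ge2$ be an integer and let $L_n$ be the length of a random source-to-sink path in a random series-parallel network of size $n$ generated by the $b$-ary model. Let $\lambda_1,\dots,\lambda_b$ be the $b$ distinct roots of $\lambda(\lambda+1)\cdots(\lambda+b-1)=(b-1)!$, where $\lambda_1\in(0,1)$ is the unique positive real root. Then \[ \mathbb{E}(L_n)=\sum_{i=1}^{b}\frac{1}{1+\lambda_i\,(H_{\lambda_i+b-1}-H_{\lambda_i})}\binom{n+\lambda_i-1}{n-1}\sim\frac{1}{1+\lambda_1(H_{\lambda_1+b-1}-H_{\lambda_1})}\cdot\frac{n^{\lambda_1}}{\Gamma(\lambda_1+1)}\quad(n\to\infty). \]
   Context: $b$-ary model ($b\ge2$ fixed): a series-parallel network is a directed multigraph with a source and a sink; its size is its number of edges. At step $1$ it is a single edge from source to sink. At step $n\ge2$ one of the $n-1$ edges, say $(x,y)$, is chosen uniformly at random; if the out-degree of $x$ is less than $b$, an additional parallel edge $(x,y)$ is added; otherwise (out-degree of $x$ equal to $b$) the edge $(x,y)$ is replaced by $(x,z),(z,y)$ with $z$ a new node. A random source-to-sink path starts at the source and at each node of out-degree $d$ chooses one of its $d$ outgoing edges uniformly at random (independently), until the sink; its length is its number of edges. Notation: $H_{x+m}-H_x:=\sum_{k=1}^m\frac{1}{x+k}$ for $m\in\mathbb{N}$, $x\in\mathbb{C}\setminus\{-1,-2,\dots\}$; for complex $x$, $\binom{x}{k}=x(x-1)\cdots(x-k+1)/k!$. *)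

theory Defs
  imports
    "HOL-Probability.Probability"
    "HOL-Library.Landau_Symbols"
    "Graph_Theory.Digraph"
begin

(* H_{x+m} - H_x *)
definition harm_diff :: "'a::field_char_0 \<Rightarrow> nat \<Rightarrow> 'a" where
  "harm_diff x m = (\<Sum>k=1..m. 1 / (x + of_nat k))"

(* The roots of x (x + 1) ... (x + b - 1) = (b - 1)! *)
definition char_roots :: "nat \<Rightarrow> complex set" where
  "char_roots b = {x. pochhammer x b = fact (b - 1)}"

(* Growth never moves the source or the sink, so they are fixed nodes throughout. *)
abbreviation (input) source :: nat where "source \<equiv> 0"

abbreviation (input) sink :: nat where "sink \<equiv> 1"

type_synonym network = "(nat, nat) pre_digraph"

definition single_edge :: network where
  "single_edge = \<lparr>verts = {source, sink}, arcs = {0}, tail = (\<lambda>_. source), head = (\<lambda>_. sink)\<rparr>"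

definition fresh :: "nat set \<Rightarrow> nat" where
  "fresh A = (LEAST a. a \<notin> A)"

definition add_parallel :: "network \<Rightarrow> nat \<Rightarrow> network" where
  "add_parallel G e = (let e' = fresh (arcs G) in
     \<lparr>verts = verts G, arcs = insert e' (arcs G),
      tail = (tail G)(e' := tail G e), head = (head G)(e' := head G e)\<rparr>)"

(* The arc name e is reused for the first of the two arcs (x,z), (z,y) that replace e = (x,y). *)
definition subdivide :: "network \<Rightarrow> nat \<Rightarrow> network" where
  "subdivide G e = (let e' = fresh (arcs G); z = fresh (verts G) in
     \<lparr>verts = insert z (verts G), arcs = insert e' (arcs G),
      tail = (tail G)(e' := z), head = (head G)(e := z, e' := head G e)\<rparr>)"

definition grow :: "nat \<Rightarrow> network \<Rightarrow> nat \<Rightarrow> network" where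
  "grow b G e = (if out_degree G (tail G e) < b then add_parallel G e else subdivide G e)"

(* Steps are numbered from 1; the value at 0 is a dummy. *)
fun random_network :: "nat \<Rightarrow> nat \<Rightarrow> network pmf" where
  "random_network b 0 = return_pmf single_edge"
| "random_network b (Suc 0) = return_pmf single_edge"
| "random_network b (Suc (Suc n)) =
     bind_pmf (random_network b (Suc n)) (\<lambda>G.
     bind_pmf (pmf_of_set (arcs G)) (\<lambda>e.
     return_pmf (grow b G e)))"

(* The list of arcs of a random walk from v that is stopped at the sink. A subprobability
   distribution is only needed to make the recursion admissible for an arbitrary G: on the
   networks generated here no mass is lost, see lossless_path_length below. *)
partial_function (spmf) random_path :: "network \<Rightarrow> nat \<Rightarrow> nat list spmf" where
  "random_path G v =
     (if v = sink then return_spmf []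
      else bind_spmf (spmf_of_set (out_arcs G v)) (\<lambda>e.
           bind_spmf (random_path G (head G e)) (\<lambda>p.
           return_spmf (e # p))))"

(* The distribution of L_n *)
definition path_length :: "nat \<Rightarrow> nat \<Rightarrow> nat spmf" where
  "path_length b n =
     bind_spmf (spmf_of_pmf (random_network b n)) (\<lambda>G.
     map_spmf length (random_path G source))"

definition expected_path_length :: "nat \<Rightarrow> nat \<Rightarrow> real" where
  "expected_path_length b n = (\<integral>l. real l \<partial>measure_spmf (path_length b n))"

inductive leads_to_sink :: "network \<Rightarrow> nat \<Rightarrow> bool" for G where
  sink: "leads_to_sink G sink"
| step: "\<lbrakk>v \<noteq> sink; out_arcs G v \<noteq> {}; \<And>e. e \<in> out_arcs G v \<Longrightarrow> leads_to_sink G (head G e)\<rbrakk>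
         \<Longrightarrow> leads_to_sink G v"

lemma lossless_random_path:
  assumes "leads_to_sink G v" "finite (arcs G)"
  shows "lossless_spmf (random_path G v)"
  using assms
proof (induction rule: leads_to_sink.induct)
  case sink
  show ?case by (subst random_path.simps) simp
next
  case (step v)
  have "finite (out_arcs G v)"
    using step.prems by (auto simp: out_arcs_def)
  with step show ?case by (subst random_path.simps) auto
qed

lemma fresh_notin:
  assumes "finite A"
  shows "fresh A \<notin> A"
proof -
  have "\<exists>a. a \<notin> A" using assms ex_new_if_finite infinite_UNIV_nat by blast
  then show ?thesis unfolding fresh_def by (rule LeastI_ex)
qed

definition proper_network :: "network \<Rightarrow> bool" where
  "proper_network G \<longleftrightarrow> fin_digraph G \<and> arcs G \<noteq> {} \<and> source \<in> verts G \<and> sink \<in> verts G \<and>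
     (\<forall>v\<in>verts G. leads_to_sink G v)"

lemma proper_network_single_edge: "proper_network single_edge"
proof -
  have sink: "leads_to_sink single_edge sink" by (rule leads_to_sink.sink)
  moreover have "leads_to_sink single_edge source"
    by (rule leads_to_sink.step) (use sink in \<open>auto simp: single_edge_def out_arcs_def\<close>)
  ultimately show ?thesis
    by (auto simp: proper_network_def single_edge_def fin_digraph_def wf_digraph_def
        fin_digraph_axioms_def)
qed

lemma proper_network_add_parallel:
  assumes G: "proper_network G" and e: "e \<in> arcs G"
  shows "proper_network (add_parallel G e)"
proof -
  interpret fin_digraph G using G by (simp add: proper_network_def)
  have fresh: "fresh (arcs G) \<notin> arcs G" by (rule fresh_notin) simp
  let ?G' = "add_parallel G e"
  have "leads_to_sink ?G' v" if "leads_to_sink G v" for v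
    using that
  proof (induction rule: leads_to_sink.induct)
    case (step v)
    show ?case
    proof (rule leads_to_sink.step)
      have "out_arcs G v \<subseteq> out_arcs ?G' v"
        using fresh by (auto simp: add_parallel_def out_arcs_def Let_def)
      then show "out_arcs ?G' v \<noteq> {}" using step.hyps by blast
      fix a assume "a \<in> out_arcs ?G' v"
      then show "leads_to_sink ?G' (head ?G' a)"
        using step.IH[of a] step.IH[of e] e
        by (auto simp: add_parallel_def out_arcs_def Let_def split: if_splits)
    qed fact
  qed (rule leads_to_sink.sink)
  moreover have "verts ?G' = verts G" by (simp add: add_parallel_def Let_def)
  ultimately have "\<forall>v\<in>verts ?G'. leads_to_sink ?G' v" using G by (simp add: proper_network_def)
  moreover have "fin_digraph ?G'"
    using e by unfold_locales (auto simp: add_parallel_def Let_def)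
  moreover have "arcs ?G' \<noteq> {}" "source \<in> verts ?G'" "sink \<in> verts ?G'"
    using G by (simp_all add: proper_network_def add_parallel_def Let_def)
  ultimately show ?thesis unfolding proper_network_def by blast
qed

lemma proper_network_subdivide:
  assumes G: "proper_network G" and e: "e \<in> arcs G"
  shows "proper_network (subdivide G e)"
proof -
  interpret fin_digraph G using G by (simp add: proper_network_def)
  have fresh: "fresh (arcs G) \<notin> arcs G" by (rule fresh_notin) simp
  let ?G' = "subdivide G e" and ?z = "fresh (verts G)"
  have z: "?z \<notin> verts G" by (rule fresh_notin) simp
  have z_sink: "?z \<noteq> sink" using z G by (auto simp: proper_network_def)
  have tail_z: "tail G a \<noteq> ?z" if "a \<in> arcs G" for a
    using z tail_in_verts[OF that] by metis
  have z_leads: "leads_to_sink ?G' ?z" if "leads_to_sink ?G' (head G e)"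
  proof -
    have out: "out_arcs ?G' ?z = {fresh (arcs G)}"
      using tail_z by (auto simp: subdivide_def out_arcs_def Let_def)
    have head: "head ?G' (fresh (arcs G)) = head G e"
      by (simp add: subdivide_def Let_def)
    show ?thesis by (rule leads_to_sink.step) (use that z_sink out head in simp_all)
  qed
  have leads: "leads_to_sink ?G' v" if "leads_to_sink G v" "v \<in> verts G" for v
    using that
  proof (induction rule: leads_to_sink.induct)
    case (step v)
    show ?case
    proof (rule leads_to_sink.step)
      have "out_arcs G v \<subseteq> out_arcs ?G' v"
        using fresh by (auto simp: subdivide_def out_arcs_def Let_def)
      then show "out_arcs ?G' v \<noteq> {}" using step.hyps by blast
      fix a assume "a \<in> out_arcs ?G' v"
      then have a: "a \<in> out_arcs G v"
        using step.prems z by (auto simp: subdivide_def out_arcs_def Let_def split: if_splits)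
      then have "a \<noteq> fresh (arcs G)" "head G a \<in> verts G" using fresh by auto
      then have "leads_to_sink ?G' (head G a)" "head ?G' a = (if a = e then ?z else head G a)"
        using step.IH[OF a] by (simp_all add: subdivide_def Let_def)
      then show "leads_to_sink ?G' (head ?G' a)" using z_leads by (cases "a = e") simp_all
    qed fact
  qed (rule leads_to_sink.sink)
  have leads_verts: "leads_to_sink G v" if "v \<in> verts G" for v
    using G that by (simp add: proper_network_def)
  have "leads_to_sink ?G' ?z"
    using leads_verts leads z_leads head_in_verts[OF e] by blast
  moreover have "verts ?G' = insert ?z (verts G)" by (simp add: subdivide_def Let_def)
  ultimately have "\<forall>v\<in>verts ?G'. leads_to_sink ?G' v" using leads leads_verts by auto
  moreover have "fin_digraph ?G'"
    using e by unfold_locales (auto simp: subdivide_def Let_def)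
  moreover have "arcs ?G' \<noteq> {}" "source \<in> verts ?G'" "sink \<in> verts ?G'"
    using G by (simp_all add: proper_network_def subdivide_def Let_def)
  ultimately show ?thesis unfolding proper_network_def by blast
qed

lemma proper_network_random_network:
  "G \<in> set_pmf (random_network b n) \<Longrightarrow> proper_network G"
proof (induction b n arbitrary: G rule: random_network.induct)
  case (3 b n)
  then obtain G' e where G': "G' \<in> set_pmf (random_network b (Suc n))"
    "e \<in> set_pmf (pmf_of_set (arcs G'))" "G = grow b G' e" by auto
  have proper: "proper_network G'" using "3.IH" G'(1) by blast
  then interpret fin_digraph G' by (simp add: proper_network_def)
  have "e \<in> arcs G'" using G'(2) proper by (simp add: proper_network_def)
  then show ?case
    unfolding G'(3) grow_def
    using proper proper_network_add_parallel proper_network_subdivide by auto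
qed (simp_all add: proper_network_single_edge)

lemma lossless_path_length: "lossless_spmf (path_length b n)"
proof -
  have "lossless_spmf (random_path G source)" if "G \<in> set_pmf (random_network b n)" for G
    using proper_network_random_network[OF that] lossless_random_path
    by (auto simp: proper_network_def fin_digraph.finite_arcs)
  then show ?thesis by (auto simp: path_length_def)
qed

end

theory Submission
  imports
    Defs
    "HOL-Computational_Algebra.Fundamental_Theorem_Algebra"
    "HOL-Real_Asymp.Real_Asymp"
begin

text \<open>Let $W_d$ be the expected number of nodes of out-degree $d$ on a random path in a given
  network; the expected length of the path is $\sum_{d=1}^b W_d$. A node of out-degree less than
  \<^term>\<open>b\<close> still has a single successor, so a parallel edge only moves weight from $W_d$ to $W_{d+1}$,
  while subdividing an edge that leaves a node $x$ of out-degree \<^term>\<open>b\<close> adds a node of out-degree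
  1 that is visited by a fraction $1/b$ of the paths through $x$. Averaging over the $n$ edges of a
  network of size $n$ yields $W_d(n+1) = W_d(n) + \frac1n ((d-1) W_{d-1}(n) - [d<b]\, d\, W_d(n) +
  [d=1]\, W_b(n))$. The eigenvalues of this linear map are the characteristic roots, and Lagrange
  interpolation at these roots gives the coordinates of the initial vector in the basis of
  eigenvectors. The dominant root is the positive one, since \<^term>\<open>cmod (x + of_nat k) \<ge> l + real k\<close>
  whenever \<^term>\<open>Re x \<ge> l\<close>.\<close>

subsection \<open>The characteristic roots\<close>

lemma pochhammer_eq_mult_prod:
  fixes x :: "'a::field_char_0"
  assumes "b \<ge> 1"
  shows "pochhammer x b = x * (\<Prod>k=1..<b. x + of_nat k)"
  using assms by (simp add: pochhammer_prod prod.atLeast_Suc_lessThan)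

text \<open>One extreme factor of absolute value below \<open>b\<close> is split off: the last one,
  \<open>x + real b\<close>, if \<open>x\<close> already lies in the smaller interval, and otherwise
  the first one, \<open>x\<close>, with the induction hypothesis applied at
  \<open>x + 1\<close>.\<close>

lemma abs_pochhammer_less:
  fixes x :: real
  assumes "b \<ge> 2" "- real (b - 1) < x" "x < 0"
  shows "\<bar>pochhammer x b\<bar> < fact (b - 1)"
  using assms
proof (induction b arbitrary: x rule: nat_induct_at_least)
  case base
  have "\<bar>x * (x + 1)\<bar> < 1 * 1"
    unfolding abs_mult using base by (intro mult_strict_mono') auto
  then show ?case by (simp add: numeral_2_eq_2 pochhammer_rec)
next
  case (Suc b)
  have fact_b: "fact b = real b * fact (b - 1)"
    using Suc.hyps by (intro fact_reduce) auto
  show ?case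
  proof (cases "- real (b - 1) < x")
    case True
    then have "\<bar>x + real b\<bar> < real b" using Suc.hyps Suc.prems by (auto simp: of_nat_diff)
    moreover have "\<bar>pochhammer x b\<bar> < fact (b - 1)" using Suc.IH True Suc.prems by simp
    ultimately have "\<bar>pochhammer x b\<bar> * \<bar>x + real b\<bar> < fact (b - 1) * real b"
      by (intro mult_strict_mono') auto
    then show ?thesis by (simp add: pochhammer_rec' abs_mult fact_b mult.commute)
  next
    case False
    show ?thesis
    \<comment> \<open>At this point \<open>x + 1\<close> would be 0, outside the open interval; the
      product contains the factor 0 instead.\<close>
    proof (cases "x = -1")
      case True
      have "pochhammer (-1 :: real) (Suc b) = 0"
        using Suc.hyps pochhammer_of_nat_eq_0_iff[of 1 "Suc b", where 'a = real] by simp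
      then show ?thesis using True by simp
    next
      case neq: False
      have "real (b - 1) \<ge> 1" using Suc.hyps by simp
      then have "x < -1" using False neq by linarith
      then have "\<bar>pochhammer (x + 1) b\<bar> < fact (b - 1)"
        using Suc.IH[of "x + 1"] Suc.prems Suc.hyps by (simp add: of_nat_diff)
      moreover have "\<bar>x\<bar> < real b" using Suc.prems by simp
      ultimately have "\<bar>x\<bar> * \<bar>pochhammer (x + 1) b\<bar> < real b * fact (b - 1)"
        by (intro mult_strict_mono') auto
      then show ?thesis by (simp add: pochhammer_rec abs_mult fact_b)
    qed
  qed
qed

definition char_poly :: "nat \<Rightarrow> complex poly" where
  "char_poly b = (\<Prod>k<b. [:of_nat k, 1:]) - [:fact (b - 1):]"

lemma poly_char_poly: "poly (char_poly b) x = pochhammer x b - fact (b - 1)"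
  by (simp add: char_poly_def poly_prod pochhammer_prod lessThan_atLeast0 add.commute)

lemma char_roots_eq: "char_roots b = {x. poly (char_poly b) x = 0}"
  by (simp add: char_roots_def poly_char_poly)

lemma char_poly_monic:
  assumes "b \<ge> 1"
  shows "degree (char_poly b) = b" "lead_coeff (char_poly b) = 1"
proof -
  let ?P = "\<Prod>k<b. [:of_nat k, 1 :: complex:]"
  have deg: "degree ?P = b" by (subst degree_prod_eq_sum_degree) auto
  moreover have "lead_coeff ?P = 1" by (simp add: lead_coeff_prod)
  ultimately show "degree (char_poly b) = b"
    unfolding char_poly_def using assms degree_add_eq_left[of "- [:fact (b - 1):]" ?P]
    by (simp only: diff_conv_add_uminus degree_minus degree_pCons_0)
  then show "lead_coeff (char_poly b) = 1"
    using \<open>lead_coeff ?P = 1\<close> deg assms by (simp add: char_poly_def coeff_pCons split: nat.split)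
qed

lemma char_root_neq:
  assumes "b \<ge> 1" "x \<in> char_roots b" "k < b"
  shows "x + of_nat k \<noteq> 0"
proof
  assume "x + of_nat k = 0"
  then have "pochhammer x b = 0"
    using assms(3) by (auto simp: pochhammer_prod)
  with assms(2) show False by (simp add: char_roots_def)
qed

text \<open>Product rule: at a root the full product equals \<open>fact (b - 1)\<close>, so omitting
  its factor \<open>x + of_nat k\<close> amounts to dividing \<open>fact (b - 1)\<close> by
  it.\<close>

lemma poly_pderiv_char_poly:
  assumes "b \<ge> 1" "x \<in> char_roots b"
  shows "poly (pderiv (char_poly b)) x = fact (b - 1) * (\<Sum>k<b. 1 / (x + of_nat k))"
proof -
  have P: "(\<Prod>k<b. x + of_nat k) = fact (b - 1)"
    using assms(2) by (simp add: char_roots_def pochhammer_prod lessThan_atLeast0)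
  have "poly (pderiv (char_poly b)) x = (\<Sum>k<b. \<Prod>j\<in>{..<b} - {k}. x + of_nat j)"
    by (simp add: char_poly_def pderiv_diff pderiv_prod pderiv_pCons poly_sum poly_prod add.commute)
  also have "\<dots> = (\<Sum>k<b. fact (b - 1) * (1 / (x + of_nat k)))"
  proof (rule sum.cong)
    fix k assume k: "k \<in> {..<b}"
    have "(\<Prod>j<b. x + of_nat j) = (x + of_nat k) * (\<Prod>j\<in>{..<b} - {k}. x + of_nat j)"
      using k by (intro prod.remove) auto
    then show "(\<Prod>j\<in>{..<b} - {k}. x + of_nat j) = fact (b - 1) * (1 / (x + of_nat k))"
      using char_root_neq[OF assms] k P by (simp add: field_simps)
  qed simp
  finally show ?thesis by (simp add: sum_distrib_left)
qed

text \<open>The imaginary part of the sum has the sign of \<^term>\<open>- Im x\<close>, so a multiple root would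
  be real and lie strictly between \<^term>\<open>1 - real b\<close> and 0, where the polynomial is too small.\<close>

lemma sum_inverse_char_root_neq_0:
  assumes "b \<ge> 2" "x \<in> char_roots b"
  shows "(\<Sum>k<b. 1 / (x + of_nat k)) \<noteq> 0"
proof
  assume sum0: "(\<Sum>k<b. 1 / (x + of_nat k)) = 0"
  have nz: "x + of_nat k \<noteq> 0" if "k < b" for k
    using char_root_neq[of b x k] assms that by simp
  have "0 = Im (\<Sum>k<b. 1 / (x + of_nat k))" using sum0 by simp
  also have "\<dots> = - Im x * (\<Sum>k<b. 1 / (cmod (x + of_nat k))\<^sup>2)"
    by (simp add: Im_divide cmod_power2 sum_distrib_left sum_negf)
  finally have "Im x * (\<Sum>k<b. 1 / (cmod (x + of_nat k))\<^sup>2) = 0" by simp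
  moreover have "(\<Sum>k<b. 1 / (cmod (x + of_nat k))\<^sup>2) > 0"
    using nz assms(1) by (intro sum_pos) (auto simp: lessThan_empty_iff)
  ultimately have Im: "Im x = 0" by simp
  define y where "y = Re x"
  have x: "x = of_real y" using Im by (simp add: y_def complex_eq_iff)
  have nzr: "y + real k \<noteq> 0" if "k < b" for k
    using nz[OF that] unfolding x by (metis of_real_add of_real_of_nat_eq of_real_0)
  have "of_real (\<Sum>k<b. 1 / (y + real k)) = (0 :: complex)" using sum0 by (simp add: x)
  then have sumr: "(\<Sum>k<b. 1 / (y + real k)) = 0" by (simp only: of_real_eq_0_iff)
  have "y < 0"
  proof (rule ccontr)
    assume "\<not> y < 0"
    then have "y > 0" using nzr[of 0] assms(1) by simp
    then have "(\<Sum>k<b. 1 / (y + real k)) > 0" using assms(1) by (intro sum_pos) (auto simp: lessThan_empty_iff)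
    then show False using sumr by simp
  qed
  moreover have "y > - real (b - 1)"
  proof (rule ccontr)
    assume *: "\<not> y > - real (b - 1)"
    have "y + real k < 0" if "k < b" for k
    proof -
      have "real k \<le> real (b - 1)" using that by simp
      then have "y + real k \<le> 0" using * by linarith
      then show ?thesis using nzr[OF that] by simp
    qed
    then have "(\<Sum>k<b. - (1 / (y + real k))) > 0" using assms(1) by (intro sum_pos) (auto simp: lessThan_empty_iff)
    then show False using sumr by (simp add: sum_negf)
  qed
  ultimately have "\<bar>pochhammer y b\<bar> < fact (b - 1)" using abs_pochhammer_less assms(1) by simp
  moreover have "complex_of_real (pochhammer y b) = complex_of_real (fact (b - 1))"
    using assms(2) by (simp add: char_roots_def x pochhammer_of_real)
  then have "pochhammer y b = fact (b - 1)" by (simp only: of_real_eq_iff)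
  ultimately show False by simp
qed

text \<open>The sum of reciprocals in the derivative is nonzero at every root, so all roots are
  simple and the monic polynomial splits into distinct linear factors. Comparing degrees then yields
  the number of roots.\<close>

lemma char_poly_eq_prod:
  assumes "b \<ge> 2"
  shows "char_poly b = (\<Prod>z\<in>char_roots b. [:-z, 1:])"
proof -
  have "rsquarefree (char_poly b)"
    using poly_pderiv_char_poly[of b] sum_inverse_char_root_neq_0[of b] assms
    by (auto simp: rsquarefree_roots char_roots_eq)
  from complex_poly_decompose_rsquarefree[OF this] show ?thesis
    using char_poly_monic[of b] assms by (simp add: char_roots_eq)
qed

lemma finite_char_roots:
  assumes "b \<ge> 1"
  shows "finite (char_roots b)"
proof -
  have "char_poly b \<noteq> 0" using char_poly_monic(2)[OF assms] by auto
  then show ?thesis unfolding char_roots_eq by (rule poly_roots_finite)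
qed

lemma card_char_roots:
  assumes "b \<ge> 2"
  shows "card (char_roots b) = b"
proof -
  have "b = degree (char_poly b)" using char_poly_monic assms by simp
  also have "\<dots> = card (char_roots b)"
    unfolding char_poly_eq_prod[OF assms] by (subst degree_prod_eq_sum_degree) auto
  finally show ?thesis by simp
qed

section \<open>Lagrange interpolation at the characteristic roots\<close>

text \<open>\<open>f\<close> and its interpolant \<open>g\<close> agree on \<open>R\<close> and both
  have degree below \<open>card R\<close>, so they are equal. Every \<open>q z\<close> is monic of
  degree \<open>card R - 1\<close>, so the coefficient of \<open>g\<close> at that index is the sum
  of the interpolation coefficients. The sum is 0 whenever \<open>f\<close> has smaller
  degree.\<close>

lemma coeff_eq_sum_lagrange:
  fixes f :: "'a::field poly"
  assumes R: "finite R" "R \<noteq> {}" and f: "degree f < card R"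
  shows "coeff f (card R - 1) = (\<Sum>z\<in>R. poly f z / (\<Prod>w\<in>R - {z}. z - w))"
proof -
  define q where "q z = (\<Prod>w\<in>R - {z}. [:- w, 1:])" for z
  define g where "g = (\<Sum>z\<in>R. smult (poly f z / (\<Prod>w\<in>R - {z}. z - w)) (q z))"
  have deg_q: "degree (q z) = card R - 1" if "z \<in> R" for z
    using that R unfolding q_def by (subst degree_prod_eq_sum_degree) auto
  have lead_q: "coeff (q z) (card R - 1) = 1" if "z \<in> R" for z
    using deg_q[OF that] lead_coeff_prod[of "\<lambda>w. [:- w, 1:]" "R - {z}"] by (simp add: q_def)
  have poly_q: "poly (q z) w = (if w = z then \<Prod>w\<in>R - {z}. z - w else 0)"
    if "z \<in> R" "w \<in> R" for z w
    using that R by (auto simp: q_def poly_prod prod_zero_iff)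
  have nz: "(\<Prod>w\<in>R - {z}. z - w) \<noteq> 0" for z using R by (auto simp: prod_zero_iff)
  have "f = g"
  proof (rule poly_eqI_degree)
    fix w assume w: "w \<in> R"
    have "poly g w = (\<Sum>z\<in>R. if z = w then poly f w else 0)"
      unfolding g_def poly_sum using w nz by (intro sum.cong) (auto simp: poly_q)
    then show "poly f w = poly g w" using w R by simp
  next
    show "degree f < card R" by fact
    have "degree g \<le> card R - 1"
      unfolding g_def using deg_q by (intro degree_sum_le) (auto simp: R)
    moreover have "card R > 0" using R by (simp add: card_gt_0_iff)
    ultimately show "degree g < card R" by linarith
  qed
  then have "coeff f (card R - 1) = coeff g (card R - 1)" by simp
  also have "\<dots> = (\<Sum>z\<in>R. poly f z / (\<Prod>w\<in>R - {z}. z - w))"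
    unfolding g_def coeff_sum by (intro sum.cong) (simp_all add: lead_q[simplified])
  finally show ?thesis .
qed

text \<open>Polymorphic, since the exact formula uses it at complex roots and the asymptotics at the
  real root.\<close>

abbreviation (input) root_weight :: "nat \<Rightarrow> 'a::field_char_0 \<Rightarrow> 'a" where
  "root_weight b x \<equiv> 1 / (1 + x * harm_diff x (b - 1))"

text \<open>The summand for \<open>k = 0\<close> contributes the 1. This links the derivative at a
  root to the denominator of \<open>root_weight\<close>.\<close>

lemma mult_sum_inverse_eq:
  assumes "b \<ge> 1" "x \<in> char_roots b"
  shows "x * (\<Sum>k<b. 1 / (x + of_nat k)) = 1 + x * harm_diff x (b - 1)"
proof -
  have "{1..b - 1} = {1..<b}" using assms(1) by auto
  then have "(\<Sum>k<b. 1 / (x + of_nat k)) = 1 / x + harm_diff x (b - 1)"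
    using assms(1) by (simp add: harm_diff_def lessThan_atLeast0 sum.atLeast_Suc_lessThan)
  then show ?thesis using char_root_neq[OF assms, of 0] assms(1) by (simp add: field_simps)
qed

text \<open>The derivative of the characteristic polynomial at a root is the product of the
  differences to the other roots, and also \<open>fact (b - 1)\<close> times the sum of reciprocals.
  Hence \<open>root_weight b x * x\<close> is \<open>fact (b - 1)\<close> times an interpolation
  weight, and the sum extracts a top coefficient.\<close>

lemma sum_root_weight_poly:
  assumes b: "b \<ge> 2" and f: "degree f < b"
  shows "(\<Sum>x\<in>char_roots b. root_weight b x * (x * poly f x)) = fact (b - 1) * coeff f (b - 1)"
proof -
  have weight: "root_weight b x * (x * poly f x) =
      fact (b - 1) * (poly f x / (\<Prod>w\<in>char_roots b - {x}. x - w))"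
    if x: "x \<in> char_roots b" for x
  proof -
    let ?S = "\<Sum>k<b. 1 / (x + of_nat k)"
    have S: "?S \<noteq> 0" by (rule sum_inverse_char_root_neq_0[OF b x])
    have x0: "x \<noteq> 0" using char_root_neq[of b x 0] b x by simp
    have "(\<Prod>w\<in>char_roots b - {x}. x - w) = poly (pderiv (char_poly b)) x"
    proof -
      have "poly (pderiv (char_poly b)) x =
          (\<Sum>z\<in>char_roots b. \<Prod>w\<in>char_roots b - {z}. x - w)"
        by (simp add: char_poly_eq_prod[OF b] pderiv_prod pderiv_pCons poly_sum poly_prod)
      \<comment> \<open>Every summand with \<open>z\<close> different from \<open>x\<close> still
        contains the factor \<open>x - x\<close>.\<close>
      also have "\<dots> = (\<Prod>w\<in>char_roots b - {x}. x - w)"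
        using finite_char_roots[of b] b x
        by (subst sum.remove[of _ x]) (auto intro!: sum.neutral simp: prod_zero_iff)
      finally show ?thesis ..
    qed
    also have "\<dots> = fact (b - 1) * ?S" using poly_pderiv_char_poly b x by simp
    finally have D: "(\<Prod>w\<in>char_roots b - {x}. x - w) = fact (b - 1) * ?S" .
    have "1 + x * harm_diff x (b - 1) = x * ?S" using mult_sum_inverse_eq[of b x] b x by simp
    then show ?thesis unfolding D using S x0 by simp
  qed
  have "char_roots b \<noteq> {}" using card_char_roots[OF b] b by auto
  then have "coeff f (b - 1) =
      (\<Sum>x\<in>char_roots b. poly f x / (\<Prod>w\<in>char_roots b - {x}. x - w))"
    using coeff_eq_sum_lagrange[of "char_roots b" f] finite_char_roots[of b] card_char_roots[OF b] b f
    by simp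
  then show ?thesis unfolding sum_distrib_left by (simp only: sum_distrib_left weight cong: sum.cong)
qed

section \<open>Eigenvectors of the out-degree dynamics\<close>

text \<open>The eigenvector, for the eigenvalue \<^term>\<open>x\<close>, of the linear map governing the expected
  numbers of nodes of each out-degree on a random path, scaled to have entry sum 1.\<close>

definition degree_vec :: "nat \<Rightarrow> nat \<Rightarrow> complex \<Rightarrow> complex" where
  "degree_vec b d x =
     (if d = b then x else x\<^sup>2 * fact (d - 1) / fact (b - 1) * (\<Prod>k=d + 1..<b. x + of_nat k))"

text \<open>For \<open>d \<ge> 2\<close> the equation only compares neighbouring entries, whose
  products differ by at most one factor. The row \<open>d = 1\<close> closes the cycle from
  out-degree \<open>b\<close> back to 1, and it is there that the characteristic equation
  enters.\<close>

lemma degree_vec_eigen: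
  assumes b: "b \<ge> 2" and x: "x \<in> char_roots b" and d: "1 \<le> d" "d \<le> b"
  shows "x * degree_vec b d x = of_nat (d - 1) * degree_vec b (d - 1) x
    - (if d < b then of_nat d * degree_vec b d x else 0) + (if d = 1 then degree_vec b b x else 0)"
proof -
  have fact_pred: "fact (d - 1) = (of_nat (d - 1) * fact (d - 2) :: complex)" if "d \<ge> 2"
    using that fact_reduce[of "d - 1", where 'a = complex] by (simp add: numeral_2_eq_2 del: of_nat_diff)
  consider "d = b" | "d < b" "d \<ge> 2" | "d = 1" using d b by linarith
  then show ?thesis
  proof cases
    case 1
    have "b = Suc (Suc (b - 2))" using b by simp
    then obtain m where m: "b = Suc (Suc m)" by blast
    show ?thesis unfolding 1 m by (simp add: degree_vec_def power2_eq_square del: of_nat_Suc)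
  next
    case 2
    have "(\<Prod>k=d..<b. x + of_nat k) = (x + of_nat d) * (\<Prod>k=d + 1..<b. x + of_nat k)"
      using 2 by (simp add: prod.atLeast_Suc_lessThan)
    then have "of_nat (d - 1) * degree_vec b (d - 1) x = (x + of_nat d) * degree_vec b d x"
      using 2 fact_pred by (simp add: degree_vec_def numeral_2_eq_2)
    then show ?thesis using 2 by (simp add: algebra_simps)
  next
    case 3
    have "fact (b - 1) = x * (\<Prod>k=1..<b. x + of_nat k)"
      using x b pochhammer_eq_mult_prod[of b x] by (simp add: char_roots_def)
    also have "(\<Prod>k=1..<b. x + of_nat k) = (x + 1) * (\<Prod>k=2..<b. x + of_nat k)"
      using b by (simp add: prod.atLeast_Suc_lessThan numeral_2_eq_2)
    finally have "fact (b - 1) = x * (x + 1) * (\<Prod>k=2..<b. x + of_nat k)" by simp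
    moreover have "(x + 1) * degree_vec b 1 x =
        x * (x * (x + 1) * (\<Prod>k=2..<b. x + of_nat k)) / fact (b - 1)"
      using b by (simp add: degree_vec_def power2_eq_square numeral_2_eq_2 mult_ac)
    ultimately have "(x + 1) * degree_vec b 1 x = x" by (metis fact_nonzero nonzero_mult_div_cancel_right)
    then have "x * degree_vec b 1 x = - degree_vec b 1 x + x" by (simp add: algebra_simps)
    then show ?thesis using 3 b by (simp add: degree_vec_def[of b b])
  qed
qed

text \<open>Summing the eigenvector equation over \<open>d\<close> cancels all transfers from
  \<open>d\<close> to \<open>d + 1\<close> and leaves the last entry, which is \<open>x\<close>. So
  \<open>x\<close> times the sum is \<open>x\<close>, and \<open>x\<close> is nonzero.\<close>

lemma sum_degree_vec:
  assumes b: "b \<ge> 2" and x: "x \<in> char_roots b"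
  shows "(\<Sum>d=1..b. degree_vec b d x) = 1"
proof -
  let ?v = "\<lambda>d. degree_vec b d x"
  have "x * (\<Sum>d=1..b. ?v d) = (\<Sum>d=1..b. of_nat (d - 1) * ?v (d - 1))
      - (\<Sum>d=1..b. if d < b then of_nat d * ?v d else 0) + (\<Sum>d=1..b. if d = 1 then ?v b else 0)"
    unfolding sum_distrib_left sum_subtractf[symmetric] sum.distrib[symmetric]
    by (intro sum.cong) (simp_all only: degree_vec_eigen[OF b x] atLeastAtMost_iff)
  also have "(\<Sum>d=1..b. of_nat (d - 1) * ?v (d - 1)) = (\<Sum>d<b. of_nat d * ?v d)"
    by (rule sum.reindex_bij_witness[of _ Suc "\<lambda>d. d - 1"]) auto
  also have "\<dots> = (\<Sum>d=1..<b. of_nat d * ?v d)"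
    using b by (simp add: lessThan_atLeast0 sum.atLeast_Suc_lessThan)
  also have "(\<Sum>d=1..b. if d < b then of_nat d * ?v d else 0) = (\<Sum>d=1..<b. of_nat d * ?v d)"
    by (rule sum.mono_neutral_cong_right) auto
  also have "(\<Sum>d=1..b. if d = 1 then ?v b else 0) = x"
    using b by (simp add: degree_vec_def)
  finally show ?thesis using char_root_neq[of b x 0] b x by simp
qed

text \<open>This writes the initial vector, one node of out-degree 1, as a combination of the
  eigenvectors. For \<open>d < b\<close> the entry is \<open>x * poly f x\<close> with
  \<open>f\<close> of degree \<open>b - d\<close>, so the coefficient at index \<open>b - 1\<close>
  vanishes unless \<open>d = 1\<close>.\<close>

lemma sum_root_weight_degree_vec:
  assumes b: "b \<ge> 2" and d: "1 \<le> d" "d \<le> b"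
  shows "(\<Sum>x\<in>char_roots b. root_weight b x * degree_vec b d x) = of_bool (d = 1)"
proof (cases "d = b")
  case True
  then show ?thesis
    using sum_root_weight_poly[OF b, of 1] b by (simp add: degree_vec_def)
next
  case False
  define f :: "complex poly" where
    "f = smult (fact (d - 1) / fact (b - 1)) ([:0, 1:] * (\<Prod>k=d + 1..<b. [:of_nat k, 1:]))"
  have "degree (\<Prod>k=d + 1..<b. [:of_nat k, 1 :: complex:]) = b - 1 - d"
    by (subst degree_prod_eq_sum_degree) auto
  then have "degree ([:0, 1:] * (\<Prod>k=d + 1..<b. [:of_nat k, 1 :: complex:])) = b - d"
    using d False by (subst degree_mult_eq) (auto simp: prod_zero_iff)
  then have deg: "degree f = b - d" by (simp add: f_def)
  have lead: "coeff f (b - d) = fact (d - 1) / fact (b - 1)"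
    unfolding deg[symmetric]
    by (simp add: f_def lead_coeff_mult lead_coeff_prod del: mult_pCons_left)
  have "coeff f (b - 1) = of_bool (d = 1) / fact (b - 1)"
    using lead deg d by (cases "d = 1") (auto intro!: coeff_eq_0)
  moreover have "degree_vec b d x = x * poly f x" for x
    using False by (simp add: degree_vec_def f_def poly_prod power2_eq_square add.commute)
  ultimately show ?thesis using sum_root_weight_poly[OF b, of f] deg d b by simp
qed

section \<open>Solution of the linear recurrence\<close>

text \<open>The factor \<open>1 + x / of_nat n\<close> is exactly what step \<open>n\<close> of the
  recurrence does to an eigenvector with eigenvalue \<open>x\<close>.\<close>

lemma gbinomial_growth:
  fixes x :: "'a::field_char_0"
  assumes "n \<ge> 1"
  shows "(of_nat (Suc n) + x - 1) gchoose n = (1 + x / of_nat n) * ((of_nat n + x - 1) gchoose (n - 1))"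
proof -
  obtain m where n: "n = Suc m" using assms by (cases n) auto
  show ?thesis
    unfolding n by (simp add: gbinomial_pochhammer' pochhammer_rec' field_simps del: of_nat_Suc)
      (simp add: algebra_simps)
qed

text \<open>By induction \<open>w n\<close> stays a superposition of eigenvectors, each scaled by
  its own binomial coefficient. The normalisation of the eigenvectors to entry sum 1 then removes
  them from the total.\<close>

lemma linear_recurrence_solution:
  fixes w :: "nat \<Rightarrow> nat \<Rightarrow> real"
  assumes b: "b \<ge> 2"
    and init: "\<And>d. 1 \<le> d \<Longrightarrow> d \<le> b \<Longrightarrow> w 1 d = of_bool (d = 1)"
    and step: "\<And>n d. n \<ge> 1 \<Longrightarrow> 1 \<le> d \<Longrightarrow> d \<le> b \<Longrightarrow> w (Suc n) d = w n d +
      (real (d - 1) * w n (d - 1) - (if d < b then real d * w n d else 0)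
        + (if d = 1 then w n b else 0)) / real n"
    and n: "n \<ge> 1"
  shows "of_real (\<Sum>d=1..b. w n d) =
    (\<Sum>x\<in>char_roots b. root_weight b x * ((of_nat n + x - 1) gchoose (n - 1)))"
proof -
  let ?B = "\<lambda>n x :: complex. (of_nat n + x - 1) gchoose (n - 1)"
  let ?R = "char_roots b"
  let ?u = "\<lambda>n d. \<Sum>x\<in>?R. root_weight b x * degree_vec b d x * ?B n x"
  have w: "of_real (w n d) = ?u n d" if "1 \<le> d" "d \<le> b" for d
    using n that
  proof (induction n arbitrary: d rule: nat_induct_at_least)
    case base
    then show ?case using init sum_root_weight_degree_vec[OF b] by simp
  next
    case (Suc n)
    \<comment> \<open>For \<open>d = 1\<close> there is no induction hypothesis at index 0, but the
      factor \<open>of_nat (d - 1)\<close> is 0.\<close>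
    have IH: "of_nat (d - 1) * of_real (w n (d - 1)) = of_nat (d - 1) * ?u n (d - 1)"
      using Suc.IH[of "d - 1"] Suc.prems by (cases "d = 1") auto
    have "of_real (w (Suc n) d) = ?u n d + (of_nat (d - 1) * ?u n (d - 1)
        - (if d < b then of_nat d * ?u n d else 0) + (if d = 1 then ?u n b else 0)) / of_nat n"
      using Suc.IH Suc.prems b by (simp add: step[OF Suc.hyps Suc.prems] IH)
    also have "\<dots> = (\<Sum>x\<in>?R. root_weight b x * ?B n x * (degree_vec b d x +
        (of_nat (d - 1) * degree_vec b (d - 1) x - (if d < b then of_nat d * degree_vec b d x else 0)
          + (if d = 1 then degree_vec b b x else 0)) / of_nat n))"
      by (cases "d < b"; cases "d = 1")
        (simp_all add: sum_distrib_left sum_divide_distrib sum.distrib sum_subtractf sum_negf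
          algebra_simps add_divide_distrib diff_divide_distrib)
    also have "\<dots> = ?u (Suc n) d"
    proof (rule sum.cong)
      have scale: "c * B * (v + x * v / m) = c * v * ((1 + x / m) * B)" for c B v x m :: complex
        by (simp add: algebra_simps)
      fix x assume x: "x \<in> ?R"
      show "root_weight b x * ?B n x * (degree_vec b d x +
        (of_nat (d - 1) * degree_vec b (d - 1) x - (if d < b then of_nat d * degree_vec b d x else 0)
          + (if d = 1 then degree_vec b b x else 0)) / of_nat n) =
        root_weight b x * degree_vec b d x * ?B (Suc n) x"
        \<comment> \<open>Read backwards, the eigenvector equation collapses the bracket to
          \<open>x * degree_vec b d x\<close>.\<close>
        unfolding degree_vec_eigen[OF b x Suc.prems, symmetric] diff_Suc_1 gbinomial_growth[OF Suc.hyps]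
        by (simp only: scale)
    qed simp
    finally show ?case .
  qed
  have "of_real (\<Sum>d=1..b. w n d) = (\<Sum>d=1..b. ?u n d)" by (simp add: w)
  also have "\<dots> = (\<Sum>x\<in>?R. root_weight b x * (\<Sum>d=1..b. degree_vec b d x) * ?B n x)"
    by (subst sum.swap) (simp add: sum_distrib_left sum_distrib_right)
  finally show ?thesis using sum_degree_vec[OF b] by simp
qed

section \<open>Location of the dominant root\<close>

lemma pochhammer_strict_mono:
  fixes x y :: real
  assumes "0 < x" "x < y" "b \<ge> 1"
  shows "pochhammer x b < pochhammer y b"
  unfolding pochhammer_prod using assms by (intro prod_mono_strict[of 0]) auto

lemma char_roots_of_real: "complex_of_real x \<in> char_roots b \<longleftrightarrow> pochhammer x b = fact (b - 1)"
proof -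
  have "complex_of_real x \<in> char_roots b \<longleftrightarrow>
      complex_of_real (pochhammer x b) = complex_of_real (fact (b - 1))"
    by (simp add: char_roots_def pochhammer_of_real)
  then show ?thesis by (simp only: of_real_eq_iff)
qed

text \<open>Existence is the intermediate value theorem on the unit interval, where the product goes
  from 0 to \<open>fact b\<close>; uniqueness is strict monotonicity on the positive reals.\<close>

lemma positive_char_root_unique:
  assumes "b \<ge> 2"
  shows "\<exists>!x :: real. x > 0 \<and> complex_of_real x \<in> char_roots b"
proof -
  have "continuous_on {0..1} (\<lambda>x :: real. pochhammer x b)"
    unfolding pochhammer_prod by (intro continuous_intros)
  moreover have poch_0: "pochhammer 0 b = (0 :: real)"
    using assms pochhammer_of_nat_eq_0_iff[of 0 b, where 'a = real] by simp
  then have "pochhammer 0 b \<le> (fact (b - 1) :: real)" by simp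
  moreover have "(fact (b - 1) :: real) \<le> pochhammer 1 b"
    using assms by (simp add: pochhammer_fact[symmetric] fact_mono)
  ultimately obtain x :: real where "0 \<le> x" "pochhammer x b = fact (b - 1)"
    using IVT'[of "\<lambda>x :: real. pochhammer x b" 0 "fact (b - 1)" 1] by auto
  moreover from this have "x \<noteq> 0" using poch_0 by auto
  ultimately show ?thesis
  proof (intro ex1I[of _ x])
    fix y :: real assume y: "y > 0 \<and> complex_of_real y \<in> char_roots b"
    show "y = x"
      using pochhammer_strict_mono[of x y b] pochhammer_strict_mono[of y x b] assms y
        \<open>0 \<le> x\<close> \<open>x \<noteq> 0\<close> \<open>pochhammer x b = fact (b - 1)\<close>
      by (cases x y rule: linorder_cases) (auto simp: char_roots_of_real)
  qed (auto simp: char_roots_of_real)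
qed

lemma positive_char_root_less_1:
  assumes "b \<ge> 2" "complex_of_real x \<in> char_roots b"
  shows "x < 1"
proof (rule ccontr)
  assume "\<not> x < 1"
  then have "pochhammer 1 b \<le> pochhammer x b"
    using pochhammer_strict_mono[of 1 x b] assms(1) by (cases "x = 1") auto
  moreover have "(fact (b - 1) :: real) < fact b" using assms(1) by (intro fact_less_mono) auto
  ultimately show False using assms(2) by (simp add: char_roots_of_real pochhammer_fact)
qed

lemma Re_char_root_less:
  assumes b: "b \<ge> 1" and l: "complex_of_real l \<in> char_roots b" "l > 0"
    and x: "x \<in> char_roots b" "x \<noteq> complex_of_real l"
  shows "Re x < l"
proof (rule ccontr)
  assume "\<not> Re x < l"
  then have Re: "l \<le> Re x" by simp
  have le: "l + real k \<le> cmod (x + of_nat k)" for k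
    using Re complex_Re_le_cmod[of "x + of_nat k"] by simp
  \<comment> \<open>One strictly larger factor suffices. The factor for \<open>k = 0\<close> is one,
    since \<open>x\<close> differs from \<open>l\<close> in its real or its imaginary part.\<close>
  have "l < cmod x"
  proof (cases "Re x = l")
    case True
    then have "Im x \<noteq> 0" using x(2) by (auto simp: complex_eq_iff)
    then have "l\<^sup>2 < (cmod x)\<^sup>2" using True by (simp add: cmod_power2)
    then show ?thesis by (rule power2_less_imp_less) simp
  next
    case False
    then show ?thesis using Re complex_Re_le_cmod[of x] by simp
  qed
  have "x + of_nat k \<noteq> 0" for k using le[of k] l(2) by auto
  then have "pochhammer l b < (\<Prod>k=0..<b. cmod (x + of_nat k))"
    unfolding pochhammer_prod using b \<open>l < cmod x\<close> le l(2)
    by (intro prod_mono_strict[of 0]) auto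
  also have "\<dots> = cmod (pochhammer x b)" by (simp add: pochhammer_prod prod_norm)
  finally show False using l(1) x(1) by (simp add: char_roots_of_real, simp add: char_roots_def)
qed

section \<open>Asymptotics of the exact formula\<close>

text \<open>After shifting \<open>n\<close> by one, the quotient is
  \<open>rGamma_series x n / x\<close> times \<open>n\<close> to the power \<open>x - l\<close>, and
  this power is eventually 1 or tends to 0. Dividing by a power of \<open>n - 1\<close> instead of
  \<open>n\<close> makes the match with \<open>rGamma_series\<close> exact.\<close>

lemma gbinomial_over_powr_tendsto:
  fixes x :: complex and l :: real
  assumes "x \<noteq> 0" "x = of_real l \<or> Re x < l"
  shows "(\<lambda>n. ((of_nat n + x - 1) gchoose (n - 1)) / of_real (real (n - 1) powr l))
    \<longlonglongrightarrow> (if x = of_real l then rGamma (x + 1) else 0)"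
proof (rule LIMSEQ_imp_Suc)
  have eq: "((of_nat (Suc n) + x - 1) gchoose (Suc n - 1)) / of_real (real (Suc n - 1) powr l) =
      rGamma_series x n / x * exp ((x - of_real l) * of_real (ln (real n)))" if "n > 0" for n
  proof -
    have "((of_nat (Suc n) + x - 1) gchoose n) = pochhammer x (n + 1) / (x * fact n)"
      using assms(1) by (simp add: gbinomial_pochhammer' pochhammer_rec add_ac)
    moreover have "of_real (real n powr l) = exp (of_real l * of_real (ln (real n)) :: complex)"
      using that by (simp add: powr_def exp_of_real[symmetric])
    ultimately show ?thesis
      using assms(1) by (simp add: rGamma_series_def left_diff_distrib exp_diff)
  qed
  have exp_lim: "(\<lambda>n. exp ((x - of_real l) * of_real (ln (real n)))) \<longlonglongrightarrow> (if x = of_real l then 1 else 0)"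
  proof (cases "x = of_real l")
    case False
    then have "Re x - l < 0" using assms(2) by simp
    then have "filterlim (\<lambda>n. (Re x - l) * ln (real n)) at_bot sequentially"
      by real_asymp
    then have "(\<lambda>n. exp ((Re x - l) * ln (real n))) \<longlonglongrightarrow> 0"
      by (rule filterlim_compose[OF exp_at_bot])
    then have "(\<lambda>n. norm (exp ((x - of_real l) * of_real (ln (real n))))) \<longlonglongrightarrow> 0" by simp
    then show ?thesis unfolding if_not_P[OF False] by (rule tendsto_norm_zero_cancel)
  qed simp
  have "(\<lambda>n. rGamma_series x n / x * exp ((x - of_real l) * of_real (ln (real n))))
      \<longlonglongrightarrow> rGamma x / x * (if x = of_real l then 1 else 0)"
    using assms(1) by (intro tendsto_intros exp_lim)
  moreover have "rGamma x / x = rGamma (x + 1)" using assms(1) rGamma_plus1[of x] by (simp add: field_simps)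
  then have "rGamma x / x * (if x = of_real l then 1 else 0) =
      (if x = of_real l then rGamma (x + 1) else 0)" by simp
  ultimately have "(\<lambda>n. rGamma_series x n / x * exp ((x - of_real l) * of_real (ln (real n))))
      \<longlonglongrightarrow> (if x = of_real l then rGamma (x + 1) else 0)" by (simp only:)
  then show "(\<lambda>n. ((of_nat (Suc n) + x - 1) gchoose (Suc n - 1)) / of_real (real (Suc n - 1) powr l))
      \<longlonglongrightarrow> (if x = of_real l then rGamma (x + 1) else 0)"
    by (rule Lim_transform_eventually)
      (rule eventually_mono[OF eventually_gt_at_top[of 0]], erule eq[symmetric])
qed

text \<open>After division by the power of \<open>n - 1\<close> with exponent \<open>l\<close>,
  every root except \<open>l\<close> contributes 0 in the limit.\<close>

lemma asymp_equiv_sum_gbinomial: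
  fixes E :: "nat \<Rightarrow> real" and l :: real
  assumes b: "b \<ge> 2"
    and E: "\<And>n. n \<ge> 1 \<Longrightarrow> complex_of_real (E n) =
      (\<Sum>x\<in>char_roots b. root_weight b x * ((of_nat n + x - 1) gchoose (n - 1)))"
    and l: "complex_of_real l \<in> char_roots b" "l > 0"
  shows "E \<sim>[at_top] (\<lambda>n. root_weight b l * (real n powr l / Gamma (l + 1)))"
proof -
  let ?R = "char_roots b"
  let ?c = "root_weight b l / Gamma (l + 1)"
  have "(\<lambda>n. \<Sum>x\<in>?R. root_weight b x *
      (((of_nat n + x - 1) gchoose (n - 1)) / of_real (real (n - 1) powr l)))
    \<longlonglongrightarrow> (\<Sum>x\<in>?R. root_weight b x * (if x = of_real l then rGamma (x + 1) else 0))"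
    using Re_char_root_less[of b l] char_root_neq[of b _ 0] b l
    by (intro tendsto_sum tendsto_mult tendsto_const gbinomial_over_powr_tendsto) auto
  also have "(\<Sum>x\<in>?R. root_weight b x * (if x = of_real l then rGamma (x + 1) else 0)) =
      root_weight b (of_real l) * rGamma (of_real l + 1)"
    using l finite_char_roots[of b] b by (simp add: if_distrib[of "\<lambda>x. _ * x"] cong: if_cong)
  also have "\<dots> = of_real ?c"
  proof -
    have "harm_diff (complex_of_real l) (b - 1) = of_real (harm_diff l (b - 1))"
      by (simp add: harm_diff_def)
    moreover have "rGamma (complex_of_real l + 1) = of_real (inverse (Gamma (l + 1)))"
      by (metis Gamma_complex_of_real of_real_1 of_real_add of_real_inverse rGamma_inverse_Gamma)
    ultimately show ?thesis by (simp add: field_simps)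
  qed
  finally have "(\<lambda>n. \<Sum>x\<in>?R. root_weight b x *
      (((of_nat n + x - 1) gchoose (n - 1)) / of_real (real (n - 1) powr l))) \<longlonglongrightarrow> of_real ?c" .
  moreover have "eventually (\<lambda>n. (\<Sum>x\<in>?R. root_weight b x *
      (((of_nat n + x - 1) gchoose (n - 1)) / of_real (real (n - 1) powr l))) =
      complex_of_real (E n / real (n - 1) powr l)) sequentially"
    using eventually_ge_at_top[of 1] by eventually_elim (simp add: E sum_divide_distrib)
  ultimately have "(\<lambda>n. complex_of_real (E n / real (n - 1) powr l)) \<longlonglongrightarrow> of_real ?c"
    by (rule Lim_transform_eventually)
  then have lim: "(\<lambda>n. E n / real (n - 1) powr l) \<longlonglongrightarrow> ?c" by (simp only: tendsto_of_real_iff)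
  \<comment> \<open>From here on the normalisation by \<open>n - 1\<close> is exchanged for the one
    by \<open>n\<close>.\<close>
  have "(\<lambda>n. real (n - 1) powr l / real n powr l) \<longlonglongrightarrow> 1" by real_asymp
  from tendsto_mult[OF lim this] have "(\<lambda>n. E n / real (n - 1) powr l * (real (n - 1) powr l / real n powr l)) \<longlonglongrightarrow> ?c"
    by simp
  moreover have "eventually (\<lambda>n. E n / real (n - 1) powr l * (real (n - 1) powr l / real n powr l) = E n / real n powr l) sequentially"
    using eventually_gt_at_top[of 1] by eventually_elim simp
  ultimately have lim: "(\<lambda>n. E n / real n powr l) \<longlonglongrightarrow> ?c"
    by (rule Lim_transform_eventually)
  \<comment> \<open>The limit must be nonzero for convergence of the quotient to give asymptotic
    equivalence.\<close>
  have "harm_diff l (b - 1) \<ge> 0" unfolding harm_diff_def using l by (intro sum_nonneg) auto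
  then have "1 + l * harm_diff l (b - 1) > 0" using l by (intro add_pos_nonneg) auto
  moreover have "Gamma (l + 1) > 0" using l by (intro Gamma_real_pos) auto
  ultimately have "?c \<noteq> 0" by simp
  then have "(\<lambda>n. E n / real n powr l / ?c) \<longlonglongrightarrow> ?c / ?c" by (intro tendsto_divide lim tendsto_const)
  then have "(\<lambda>n. E n / (root_weight b l * (real n powr l / Gamma (l + 1)))) \<longlonglongrightarrow> 1"
    using \<open>?c \<noteq> 0\<close> by (simp add: field_simps)
  then show ?thesis by (rule asymp_equivI')
qed

subsection \<open>Rewards collected on a random path\<close>

text \<open>The networks and paths below have finite support, so expectations can be handled as
  finite sums.\<close>

lemma integral_measure_spmf_finite:
  fixes f :: "'a \<Rightarrow> real"
  assumes "finite S" "set_spmf p \<subseteq> S"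
  shows "(\<integral>x. f x \<partial>measure_spmf p) = (\<Sum>x\<in>S. spmf p x * f x)"
proof -
  have "(\<integral>x. f x \<partial>measure_spmf p) = (\<integral>x. (\<Sum>y\<in>S. f y * indicator {y} x) \<partial>measure_spmf p)"
    using assms by (intro integral_cong_AE)
      (auto simp: AE_measure_spmf_iff indicator_def if_distrib[of "\<lambda>x. _ * x"] cong: if_cong)
  also have "\<dots> = (\<Sum>y\<in>S. f y * spmf p y)"
    by (subst Bochner_Integration.integral_sum)
      (auto simp: spmf_conv_measure_spmf measure_spmf.emeasure_eq_measure)
  finally show ?thesis by (simp add: mult.commute)
qed

text \<open>Over the union \<open>?T\<close> of the inner supports all inner integrals are sums with
  the same index set, so the two summations can be swapped.\<close>

lemma integral_bind_spmf_finite: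
  fixes f :: "'b \<Rightarrow> real"
  assumes "finite (set_spmf p)" "\<And>x. x \<in> set_spmf p \<Longrightarrow> finite (set_spmf (q x))"
  shows "(\<integral>y. f y \<partial>measure_spmf (bind_spmf p q)) =
    (\<integral>x. (\<integral>y. f y \<partial>measure_spmf (q x)) \<partial>measure_spmf p)"
proof -
  let ?S = "set_spmf p" and ?T = "\<Union>x\<in>set_spmf p. set_spmf (q x)"
  have T: "finite ?T" using assms by blast
  have "(\<integral>y. f y \<partial>measure_spmf (bind_spmf p q)) = (\<Sum>y\<in>?T. (\<Sum>x\<in>?S. spmf p x * spmf (q x) y) * f y)"
    using T assms(1)
    by (subst integral_measure_spmf_finite[of ?T])
      (auto simp: set_bind_spmf bind_UNION spmf_bind integral_measure_spmf_finite[of ?S])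
  also have "\<dots> = (\<Sum>x\<in>?S. spmf p x * (\<Sum>y\<in>?T. spmf (q x) y * f y))"
    unfolding sum_distrib_left sum_distrib_right by (subst sum.swap) (simp add: mult_ac)
  also have "\<dots> = (\<Sum>x\<in>?S. spmf p x * (\<integral>y. f y \<partial>measure_spmf (q x)))"
    using T by (intro sum.cong refl arg_cong2[where f = "(*)"] integral_measure_spmf_finite[symmetric]) auto
  also have "\<dots> = (\<integral>x. (\<integral>y. f y \<partial>measure_spmf (q x)) \<partial>measure_spmf p)"
    using assms(1) by (subst integral_measure_spmf_finite[of ?S]) auto
  finally show ?thesis .
qed

lemma finite_out_arcs: "finite (arcs G) \<Longrightarrow> finite (out_arcs G v)"
  by (simp add: out_arcs_def)

text \<open>Since \<open>leads_to_sink\<close> is inductive, no walk from \<open>v\<close> runs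
  forever, and each node offers finitely many arcs.\<close>

lemma finite_set_random_path:
  assumes "leads_to_sink G v" "finite (arcs G)"
  shows "finite (set_spmf (random_path G v))"
  using assms
proof (induction rule: leads_to_sink.induct)
  case sink
  show ?case by (subst random_path.simps) simp
next
  case (step v)
  then show ?case
    by (subst random_path.simps) (auto simp: set_bind_spmf bind_UNION finite_out_arcs)
qed

text \<open>A path visits the tails of its arcs and then the sink, so the value of \<^term>\<open>r\<close> at the sink
  never counts.\<close>

definition expected_reward :: "network \<Rightarrow> (nat \<Rightarrow> real) \<Rightarrow> nat \<Rightarrow> real" where
  "expected_reward G r v = (\<integral>p. (\<Sum>e\<leftarrow>p. r (tail G e)) \<partial>measure_spmf (random_path G v))"

text \<open>\<open>sink\<close> abbreviates 1, which the simplifier rewrites to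
  \<open>Suc 0\<close>; the rule is stored in that form so that it matches.\<close>

lemma expected_reward_sink [unfolded One_nat_def, simp]: "expected_reward G r sink = 0"
  unfolding expected_reward_def
  by (subst random_path.simps) (simp add: integral_measure_spmf_finite[of "{[]}"])

text \<open>First-step analysis. All later statements about rewards on changed networks are proved
  by induction along \<open>leads_to_sink\<close> with this equation.\<close>

lemma expected_reward_step:
  assumes "leads_to_sink G v" "finite (arcs G)" "v \<noteq> sink"
  shows "expected_reward G r v =
    r v + (\<Sum>e\<in>out_arcs G v. expected_reward G r (head G e)) / real (out_degree G v)"
proof -
  let ?O = "out_arcs G v"
  have O: "finite ?O" "?O \<noteq> {}" and leads: "\<And>e. e \<in> ?O \<Longrightarrow> leads_to_sink G (head G e)"
    using assms by (auto simp: finite_out_arcs elim: leads_to_sink.cases)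
  let ?f = "\<lambda>p. \<Sum>e\<leftarrow>p. r (tail G e)"
  have step: "(\<integral>p. ?f p \<partial>measure_spmf (bind_spmf (random_path G (head G e)) (\<lambda>p. return_spmf (e # p)))) =
      r v + expected_reward G r (head G e)" if e: "e \<in> ?O" for e
  proof -
    let ?P = "random_path G (head G e)"
    have fin: "finite (set_spmf ?P)" by (rule finite_set_random_path) (use leads e assms in auto)
    have tail: "tail G e = v" using e by simp
    \<comment> \<open>Total mass 1 lets the constant \<open>r v\<close> leave the integral with
      coefficient 1.\<close>
    have "lossless_spmf ?P" by (rule lossless_random_path) (use leads e assms in auto)
    then have "(\<integral>x. 1 \<partial>measure_spmf ?P) = (1 :: real)"
      by (simp add: lossless_spmf_def weight_spmf_def)
    then have one: "(\<Sum>p\<in>set_spmf ?P. spmf ?P p) = 1"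
      using integral_measure_spmf_finite[OF fin order.refl, of "\<lambda>_. 1"] by simp
    have "(\<integral>p. ?f p \<partial>measure_spmf (bind_spmf ?P (\<lambda>p. return_spmf (e # p)))) =
        (\<integral>p. r v + ?f p \<partial>measure_spmf ?P)"
      using fin by (subst integral_bind_spmf_finite)
        (auto simp: integral_measure_spmf_finite[of "{_ # _}"] tail)
    also have "\<dots> = r v + expected_reward G r (head G e)"
      using one unfolding expected_reward_def integral_measure_spmf_finite[OF fin order.refl]
      by (simp add: distrib_left sum.distrib flip: sum_distrib_right)
    finally show ?thesis .
  qed
  have "expected_reward G r v = (\<integral>e. (\<integral>p. ?f p \<partial>measure_spmf
      (bind_spmf (random_path G (head G e)) (\<lambda>p. return_spmf (e # p)))) \<partial>measure_spmf (spmf_of_set ?O))"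
    unfolding expected_reward_def using O leads finite_set_random_path assms
    by (subst random_path.simps, simp, subst integral_bind_spmf_finite) (auto simp: set_bind_spmf bind_UNION)
  also have "\<dots> = (\<Sum>e\<in>?O. 1 / real (card ?O) * (r v + expected_reward G r (head G e)))"
    using O by (subst integral_measure_spmf_finite[of ?O]) (auto simp: step spmf_of_set)
  also have "\<dots> = r v + (\<Sum>e\<in>?O. expected_reward G r (head G e)) / real (out_degree G v)"
    using O by (simp add: out_degree_def distrib_left sum.distrib add_divide_distrib
        flip: sum_distrib_left sum_divide_distrib)
  finally show ?thesis .
qed

lemma proper_networkD:
  assumes "proper_network G"
  shows "fin_digraph G" "finite (arcs G)" "source \<in> verts G" "v \<in> verts G \<Longrightarrow> leads_to_sink G v"
  using assms by (auto simp: proper_network_def fin_digraph.finite_arcs)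

lemma expected_reward_cong:
  assumes G: "proper_network G" and v: "v \<in> verts G"
    and r: "\<And>u. u \<in> verts G \<Longrightarrow> u \<noteq> sink \<Longrightarrow> r u = s u"
  shows "expected_reward G r v = expected_reward G s v"
  using proper_networkD(4)[OF G v] v
proof (induction rule: leads_to_sink.induct)
  case (step v)
  interpret fin_digraph G by (rule proper_networkD(1)[OF G])
  show ?case
    using step r[of v] proper_networkD(4)[OF G] head_in_verts
    by (simp add: expected_reward_step)
qed simp

lemma expected_reward_sum:
  assumes "leads_to_sink G v" "finite (arcs G)"
  shows "expected_reward G (\<lambda>u. \<Sum>i\<in>I. r i u) v = (\<Sum>i\<in>I. expected_reward G (r i) v)"
proof -
  have "(\<Sum>e\<leftarrow>p. \<Sum>i\<in>I. r i (tail G e)) = (\<Sum>i\<in>I. \<Sum>e\<leftarrow>p. r i (tail G e))" for p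
    by (induction p) (simp_all add: sum.distrib)
  then show ?thesis
    unfolding expected_reward_def integral_measure_spmf_finite[OF finite_set_random_path[OF assms] order.refl]
    by (simp add: sum_distrib_left) (rule sum.swap)
qed

lemma expected_reward_add:
  assumes "leads_to_sink G v" "finite (arcs G)"
  shows "expected_reward G (\<lambda>u. r u + s u) v = expected_reward G r v + expected_reward G s v"
  unfolding expected_reward_def integral_measure_spmf_finite[OF finite_set_random_path[OF assms] order.refl]
  by (simp add: sum_list_addf distrib_left sum.distrib)

lemma expected_reward_cmult:
  assumes "leads_to_sink G v" "finite (arcs G)"
  shows "expected_reward G (\<lambda>u. c * r u) v = c * expected_reward G r v"
  unfolding expected_reward_def integral_measure_spmf_finite[OF finite_set_random_path[OF assms] order.refl]
  by (simp add: sum_list_const_mult sum_distrib_left mult_ac)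

section \<open>Effect of one growth operation on expected rewards\<close>

lemma out_arcs_add_parallel:
  assumes "finite (arcs G)"
  shows "out_arcs (add_parallel G e) v =
    (if v = tail G e then insert (fresh (arcs G)) (out_arcs G v) else out_arcs G v)"
  using fresh_notin[OF assms] by (auto simp: add_parallel_def out_arcs_def Let_def)

lemma out_degree_add_parallel:
  assumes "finite (arcs G)"
  shows "out_degree (add_parallel G e) v = (if v = tail G e then Suc (out_degree G v) else out_degree G v)"
  using fresh_notin[OF assms] finite_out_arcs[OF assms]
  by (auto simp: out_degree_def out_arcs_add_parallel[OF assms])

text \<open>All arcs leaving the tail of \<open>e\<close> share one head, so a further copy does not
  change the average over successors. The reward \<open>r\<close> is kept fixed here; the changed
  out-degree is accounted for when \<open>r\<close> is instantiated.\<close>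

lemma expected_reward_add_parallel:
  assumes G: "proper_network G" and e: "e \<in> arcs G" and v: "v \<in> verts G"
    and parallel: "\<And>a. a \<in> arcs G \<Longrightarrow> tail G a = tail G e \<Longrightarrow> head G a = head G e"
  shows "expected_reward (add_parallel G e) r v = expected_reward G r v"
  using proper_networkD(4)[OF G v] v
proof (induction rule: leads_to_sink.induct)
  case (step v)
  interpret fin_digraph G by (rule proper_networkD(1)[OF G])
  let ?G' = "add_parallel G e"
  have fresh: "fresh (arcs G) \<notin> arcs G" by (rule fresh_notin) simp
  have G': "proper_network ?G'" by (rule proper_network_add_parallel[OF G e])
  have verts: "verts ?G' = verts G" by (simp add: add_parallel_def Let_def)
  have IH: "expected_reward ?G' r (head ?G' a) = expected_reward G r (head G a)"
    if "a \<in> out_arcs G v" for a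
    using step.IH[OF that] that fresh head_in_verts by (auto simp: add_parallel_def Let_def)
  have "(\<Sum>a\<in>out_arcs ?G' v. expected_reward ?G' r (head ?G' a)) / real (out_degree ?G' v) =
      (\<Sum>a\<in>out_arcs G v. expected_reward G r (head G a)) / real (out_degree G v)"
  proof (cases "v = tail G e")
    case True
    have e': "e \<in> out_arcs G v" using e True by simp
    have heads: "head G a = head G e" if "a \<in> out_arcs G v" for a using that parallel True by simp
    have new: "head ?G' (fresh (arcs G)) = head G e" by (simp add: add_parallel_def Let_def)
    \<comment> \<open>The new arc is not covered by the induction hypothesis, but it has the same
      head as \<open>e\<close>, which is.\<close>
    have "expected_reward ?G' r (head G e) = expected_reward G r (head G e)"
      using step.IH[OF e'] head_in_verts[OF e] by simp
    then have "(\<Sum>a\<in>out_arcs ?G' v. expected_reward ?G' r (head ?G' a)) =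
        real (Suc (card (out_arcs G v))) * expected_reward G r (head G e)"
      using True fresh IH heads new
      by (simp add: out_arcs_add_parallel finite_out_arcs algebra_simps)
    moreover have "(\<Sum>a\<in>out_arcs G v. expected_reward G r (head G a)) =
        real (card (out_arcs G v)) * expected_reward G r (head G e)"
      using heads by simp
    moreover have "card (out_arcs G v) > 0" using e' by (auto simp: card_gt_0_iff finite_out_arcs)
    moreover have "out_degree G v = card (out_arcs G v)" "out_degree ?G' v = Suc (card (out_arcs G v))"
      using True by (simp_all add: out_degree_add_parallel, simp_all add: out_degree_def)
    ultimately show ?thesis by (simp del: of_nat_Suc)
  qed (use IH in \<open>simp add: out_arcs_add_parallel out_degree_add_parallel\<close>)
  then show ?case
    using step proper_networkD(4)[OF G] proper_networkD(4)[OF G'] proper_networkD(2)[OF G'] verts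
    by (simp add: expected_reward_step)
qed simp

lemma out_arcs_subdivide:
  assumes "fin_digraph G"
  shows "out_arcs (subdivide G e) v = (if v = fresh (verts G) then {fresh (arcs G)} else out_arcs G v)"
proof -
  interpret fin_digraph G by fact
  have "fresh (arcs G) \<notin> arcs G" by (simp add: fresh_notin)
  moreover have "tail G a \<noteq> fresh (verts G)" if "a \<in> arcs G" for a
    using tail_in_verts[OF that] fresh_notin[OF finite_verts] by metis
  ultimately show ?thesis by (auto simp: subdivide_def out_arcs_def Let_def)
qed

lemma out_degree_subdivide:
  assumes "fin_digraph G"
  shows "out_degree (subdivide G e) v = (if v = fresh (verts G) then 1 else out_degree G v)"
  by (simp add: out_degree_def out_arcs_subdivide[OF assms])

text \<open>The new node \<open>z\<close> is entered exactly when a walk at the tail of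
  \<open>e\<close> picks \<open>e\<close>, which happens with probability 1 over the out-degree. So
  the reward of \<open>z\<close> can be credited to that tail in the old network.\<close>

lemma expected_reward_subdivide:
  fixes r :: "nat \<Rightarrow> real"
  assumes G: "proper_network G" and e: "e \<in> arcs G" and v: "v \<in> verts G"
  defines "z \<equiv> fresh (verts G)"
  defines "r' \<equiv> \<lambda>u. r u + (if u = tail G e then r z / real (out_degree G u) else 0)"
  shows "expected_reward (subdivide G e) r v = expected_reward G r' v"
  using proper_networkD(4)[OF G v] v
proof (induction rule: leads_to_sink.induct)
  case (step v)
  interpret fin_digraph G by (rule proper_networkD(1)[OF G])
  let ?G' = "subdivide G e" and ?e' = "fresh (arcs G)"
  have fresh: "?e' \<notin> arcs G" by (rule fresh_notin) simp
  have z: "z \<notin> verts G" unfolding z_def by (rule fresh_notin) simp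
  have z_sink: "z \<noteq> sink" using z G by (auto simp: proper_network_def)
  have G': "proper_network ?G'" by (rule proper_network_subdivide[OF G e])
  have verts: "verts ?G' = insert z (verts G)" by (simp add: subdivide_def Let_def z_def)
  have out_z: "out_arcs ?G' z = {?e'}"
    using out_arcs_subdivide[OF fin_digraph_axioms] by (simp add: z_def)
  have head: "head ?G' a = (if a = ?e' then head G e else if a = e then z else head G a)" for a
    by (simp add: subdivide_def Let_def z_def)
  have reward_z: "expected_reward ?G' r z = r z + expected_reward ?G' r (head G e)"
    using proper_networkD[OF G'] z_sink verts out_z
    by (simp add: expected_reward_step out_degree_def head)
  have v: "out_arcs ?G' v = out_arcs G v" "out_degree ?G' v = out_degree G v"
    using step.prems z out_arcs_subdivide[OF fin_digraph_axioms]
    by (auto simp: z_def[symmetric] out_degree_def)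
  \<comment> \<open>Among the old arcs only \<open>e\<close> has a new head, namely
    \<open>z\<close>, from where the walk continues to the old head of \<open>e\<close>.\<close>
  have "expected_reward ?G' r (head ?G' a) = expected_reward G r' (head G a) + (if a = e then r z else 0)"
    if "a \<in> out_arcs G v" for a
    using step.IH[OF that] that fresh head_in_verts by (auto simp: head reward_z)
  then have "(\<Sum>a\<in>out_arcs ?G' v. expected_reward ?G' r (head ?G' a)) =
      (\<Sum>a\<in>out_arcs G v. expected_reward G r' (head G a)) + (if v = tail G e then r z else 0)"
    using e by (simp add: v sum.distrib finite_out_arcs)
  then show ?case
    using step proper_networkD(4)[OF G] proper_networkD(4)[OF G'] proper_networkD(2)[OF G'] verts
    by (simp add: expected_reward_step v r'_def add_divide_distrib)
qed simp

section \<open>Invariants of the model and visits counted by out-degree\<close>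

text \<open>The last clause is the invariant that makes \<open>expected_reward_add_parallel\<close>
  applicable: arcs are subdivided only at nodes of full out-degree, so until then all arcs leaving a
  node are parallel.\<close>

definition bary_network :: "nat \<Rightarrow> network \<Rightarrow> bool" where
  "bary_network b G \<longleftrightarrow> proper_network G \<and> (\<forall>v. out_degree G v \<le> b) \<and>
     (\<forall>a\<in>arcs G. \<forall>a'\<in>arcs G. tail G a = tail G a' \<and> out_degree G (tail G a) < b \<longrightarrow>
        head G a = head G a')"

lemma bary_networkD:
  assumes "bary_network b G"
  shows "proper_network G" "out_degree G v \<le> b"
    and "\<lbrakk>a \<in> arcs G; a' \<in> arcs G; tail G a = tail G a'; out_degree G (tail G a) < b\<rbrakk>
      \<Longrightarrow> head G a = head G a'"
  using assms unfolding bary_network_def by blast+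

lemma bary_network_single_edge:
  assumes "b \<ge> 1"
  shows "bary_network b single_edge"
proof -
  have "out_arcs single_edge v \<subseteq> {0}" for v by (auto simp: single_edge_def out_arcs_def)
  then have "out_degree single_edge v \<le> 1" for v
    unfolding out_degree_def using card_mono[of "{0 :: nat}"] by fastforce
  then show ?thesis
    using assms proper_network_single_edge
    by (auto simp: bary_network_def single_edge_def intro: order.trans)
qed

lemma card_arcs_grow:
  assumes "finite (arcs G)"
  shows "card (arcs (grow b G e)) = Suc (card (arcs G))"
  using assms fresh_notin[OF assms] by (simp add: grow_def add_parallel_def subdivide_def Let_def)

lemma bary_network_grow:
  assumes G: "bary_network b G" and e: "e \<in> arcs G" and b: "b \<ge> 1"
  shows "bary_network b (grow b G e)"
proof -
  note proper = bary_networkD(1)[OF G] and deg = bary_networkD(2)[OF G]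
    and parallel = bary_networkD(3)[OF G]
  interpret fin_digraph G by (rule proper_networkD(1)[OF proper])
  have fresh: "fresh (arcs G) \<notin> arcs G" by (simp add: fresh_notin)
  have tail_fresh: "tail G a \<noteq> fresh (verts G)" if "a \<in> arcs G" for a
    using tail_in_verts[OF that] fresh_notin[OF finite_verts] by metis
  show ?thesis
  proof (cases "out_degree G (tail G e) < b")
    case True
    let ?G' = "add_parallel G e"
    have "out_degree ?G' v \<le> b" for v
      using deg[of v] True by (auto simp: out_degree_add_parallel)
    moreover have "head ?G' a = head ?G' a'"
      if "a \<in> arcs ?G'" "a' \<in> arcs ?G'" "tail ?G' a = tail ?G' a'" "out_degree ?G' (tail ?G' a) < b" for a a'
    proof -
      have "out_degree G (tail ?G' a) < b"
        using that(4) by (auto simp: out_degree_add_parallel split: if_splits)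
      then show ?thesis
        using that(1-3) parallel[of a a'] parallel[of a e] parallel[of e a'] e fresh
        by (auto simp: add_parallel_def Let_def split: if_splits)
    qed
    ultimately show ?thesis
      using proper_network_add_parallel[OF proper e]
      unfolding grow_def if_P[OF True] bary_network_def by blast
  next
    case False
    let ?G' = "subdivide G e"
    have "out_degree ?G' v \<le> b" for v
      using deg[of v] b by (auto simp: out_degree_subdivide[OF fin_digraph_axioms])
    moreover have "head ?G' a = head ?G' a'"
      if a: "a \<in> arcs ?G'" "a' \<in> arcs ?G'" "tail ?G' a = tail ?G' a'" "out_degree ?G' (tail ?G' a) < b" for a a'
    proof (cases "a = fresh (arcs G) \<or> a' = fresh (arcs G)")
      case True
      \<comment> \<open>The new arc is the only one that leaves the new node.\<close>
      then have "a = a'"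
        using a(1-3) fresh tail_fresh tail_fresh[symmetric] by (auto simp: subdivide_def Let_def split: if_splits)
      then show ?thesis by simp
    next
      case old: False
      then have a_arcs: "a \<in> arcs G" "a' \<in> arcs G" and tails: "tail G a = tail G a'" "tail ?G' a = tail G a"
        using a(1-3) by (auto simp: subdivide_def Let_def)
      have "out_degree G (tail G a) < b"
        using a(4) tails(2) tail_fresh[OF a_arcs(1)]
        by (auto simp: out_degree_subdivide[OF fin_digraph_axioms] split: if_splits)
      \<comment> \<open>The subdivided arc leaves a node whose out-degree is not below
        \<open>b\<close>, so the heads of both arcs are unchanged.\<close>
      moreover from this have "a \<noteq> e" "a' \<noteq> e" using False tails by auto
      ultimately show ?thesis
        using parallel[OF a_arcs tails(1)] old by (simp add: subdivide_def Let_def)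
    qed
    ultimately show ?thesis
      using proper_network_subdivide[OF proper e]
      unfolding grow_def if_not_P[OF False] bary_network_def by blast
  qed
qed

abbreviation expected_visits :: "nat \<Rightarrow> network \<Rightarrow> real" where
  "expected_visits d G \<equiv> expected_reward G (\<lambda>v. of_bool (out_degree G v = d)) source"

text \<open>Expressing the effect of growth as a reward on the unchanged network \<open>G\<close>
  allows the average over \<open>e\<close> to be taken inside the reward, by linearity.\<close>

lemma expected_visits_grow:
  assumes G: "bary_network b G" and e: "e \<in> arcs G"
  shows "expected_visits d (grow b G e) = expected_reward G (\<lambda>v. of_bool (out_degree G v = d) +
    (if v = tail G e then
      (if out_degree G v < b then of_bool (Suc (out_degree G v) = d) - of_bool (out_degree G v = d)
       else of_bool (d = 1) / real b) else 0)) source"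
    (is "_ = expected_reward G ?r source")
proof -
  note proper = bary_networkD(1)[OF G] and deg = bary_networkD(2)[OF G]
  interpret fin_digraph G by (rule proper_networkD(1)[OF proper])
  have s: "source \<in> verts G" by (rule proper_networkD(3)[OF proper])
  show ?thesis
  proof (cases "out_degree G (tail G e) < b")
    case True
    have "expected_visits d (grow b G e) =
        expected_reward G (\<lambda>v. of_bool (out_degree (add_parallel G e) v = d)) source"
      unfolding grow_def if_P[OF True]
      by (rule expected_reward_add_parallel[OF proper e s]) (use True e bary_networkD(3)[OF G] in metis)
    also have "\<dots> = expected_reward G ?r source"
      using True s by (intro expected_reward_cong[OF proper]) (auto simp: out_degree_add_parallel)
    finally show ?thesis .
  next
    case False
    then have "out_degree G (tail G e) = b" using deg[of "tail G e"] by simp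
    moreover have "fresh (verts G) \<notin> verts G" by (simp add: fresh_notin)
    ultimately show ?thesis
      unfolding grow_def if_not_P[OF False] expected_reward_subdivide[OF proper e s]
      using s by (intro expected_reward_cong[OF proper])
        (auto simp: out_degree_subdivide[OF fin_digraph_axioms])
  qed
qed

text \<open>Each node \<open>v\<close> is the tail of \<open>out_degree G v\<close> arcs, so its
  correction is counted that often. This is the source of the factors \<open>d\<close> and
  \<open>d - 1\<close>.\<close>

lemma sum_expected_visits_grow:
  assumes G: "bary_network b G" and b: "b \<ge> 1" and d: "1 \<le> d" "d \<le> b"
  shows "(\<Sum>e\<in>arcs G. expected_visits d (grow b G e)) = real (card (arcs G)) * expected_visits d G +
    (real (d - 1) * expected_visits (d - 1) G - (if d < b then real d * expected_visits d G else 0)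
      + (if d = 1 then expected_visits b G else 0))"
proof -
  note proper = bary_networkD(1)[OF G] and deg = bary_networkD(2)[OF G]
  note fin = proper_networkD(2)[OF proper]
  note leads = proper_networkD(4)[OF proper proper_networkD(3)[OF proper]]
  let ?c = "\<lambda>v. if out_degree G v < b then of_bool (Suc (out_degree G v) = d) - of_bool (out_degree G v = d)
       else of_bool (d = 1) / real b"
  let ?\<delta> = "\<lambda>d v. of_bool (out_degree G v = d) :: real"
  have *: "(\<Sum>e\<in>arcs G. ?\<delta> d v + (if v = tail G e then ?c v else 0)) =
      (real (card (arcs G)) - (if d < b then real d else 0)) * ?\<delta> d v +
       (real (d - 1) * ?\<delta> (d - 1) v + (if d = 1 then 1 else 0) * ?\<delta> b v)" for v
  proof -
    have "out_arcs G v = {e \<in> arcs G. v = tail G e}" by auto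
    then have "(\<Sum>e\<in>arcs G. if v = tail G e then c else 0) = real (out_degree G v) * c" for c
      using sum.inter_filter[OF fin, of "\<lambda>_. c" "\<lambda>e. v = tail G e"] by (simp add: out_degree_def)
    \<comment> \<open>At out-degree \<open>b\<close> the number of arcs cancels the factor
      \<open>1 / real b\<close>.\<close>
    moreover have "real (out_degree G v) * ?c v = real (d - 1) * ?\<delta> (d - 1) v +
        (if d = 1 then 1 else 0) * ?\<delta> b v - (if d < b then real d else 0) * ?\<delta> d v"
      using d b deg[of v] by (cases "out_degree G v < b") auto
    ultimately have "(\<Sum>e\<in>arcs G. if v = tail G e then ?c v else 0) = real (d - 1) * ?\<delta> (d - 1) v +
        (if d = 1 then 1 else 0) * ?\<delta> b v - (if d < b then real d else 0) * ?\<delta> d v"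
      by (simp only:)
    then show ?thesis unfolding sum.distrib by (simp add: left_diff_distrib)
  qed
  have "(\<Sum>e\<in>arcs G. expected_visits d (grow b G e)) =
      expected_reward G (\<lambda>v. \<Sum>e\<in>arcs G. ?\<delta> d v + (if v = tail G e then ?c v else 0)) source"
    by (simp only: expected_visits_grow[OF G] expected_reward_sum[OF leads fin] cong: sum.cong)
  also have "\<dots> = (real (card (arcs G)) - (if d < b then real d else 0)) * expected_visits d G +
       (real (d - 1) * expected_visits (d - 1) G + (if d = 1 then 1 else 0) * expected_visits b G)"
    unfolding * expected_reward_add[OF leads fin] expected_reward_cmult[OF leads fin] ..
  finally show ?thesis by (cases "d < b"; cases "d = 1") (simp_all add: algebra_simps)
qed

lemma bary_network_random_network:
  assumes "b \<ge> 1" "n \<ge> 1" "G \<in> set_pmf (random_network b n)"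
  shows "bary_network b G \<and> card (arcs G) = n"
  using assms(2,3)
proof (induction n arbitrary: G rule: nat_induct_at_least)
  case base
  then show ?case using bary_network_single_edge[OF assms(1)] by (simp add: single_edge_def)
next
  case (Suc n)
  then obtain m where n: "n = Suc m" by (cases n) auto
  obtain G' e where G': "G' \<in> set_pmf (random_network b n)"
    "e \<in> set_pmf (pmf_of_set (arcs G'))" "G = grow b G' e"
    using Suc.prems unfolding n by auto
  have IH: "bary_network b G'" "card (arcs G') = n" using Suc.IH[OF G'(1)] by auto
  then have "finite (arcs G')" "arcs G' \<noteq> {}"
    by (auto simp: bary_network_def proper_network_def fin_digraph.finite_arcs)
  then show ?case
    using bary_network_grow[OF IH(1), of e] card_arcs_grow[of G' b e] G'(2,3) IH assms(1) by auto
qed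

lemma finite_set_random_network: "finite (set_pmf (random_network b n))"
proof (induction b n rule: random_network.induct)
  case (3 b n)
  have "finite (set_pmf (pmf_of_set (arcs G)))" if "G \<in> set_pmf (random_network b (Suc n))" for G
  proof -
    have "finite (arcs G)" "arcs G \<noteq> {}"
      using proper_network_random_network[OF that]
      by (auto simp: proper_network_def fin_digraph.finite_arcs)
    then show ?thesis by simp
  qed
  then show ?case using 3 by simp
qed simp_all

section \<open>Recurrence for the averaged visits and the expected length\<close>

text \<open>This is the quantity W_d(n) of the introductory text, averaged over the random
  network.\<close>

definition mean_visits :: "nat \<Rightarrow> nat \<Rightarrow> nat \<Rightarrow> real" where
  "mean_visits b n d = measure_pmf.expectation (random_network b n) (expected_visits d)"

lemma mean_visits_eq_sum:
  "mean_visits b n d = (\<Sum>G\<in>set_pmf (random_network b n). pmf (random_network b n) G * expected_visits d G)"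
  unfolding mean_visits_def
  by (subst integral_measure_pmf_real[OF finite_set_random_network]) (auto simp: mult.commute)

lemma mean_visits_1:
  assumes "d \<ge> 1"
  shows "mean_visits b 1 d = of_bool (d = 1)"
proof -
  have out: "out_arcs single_edge source = {0}" by (auto simp: single_edge_def out_arcs_def)
  have "leads_to_sink single_edge source" "finite (arcs single_edge)"
    using proper_networkD[OF proper_network_single_edge] by blast+
  then have "expected_visits d single_edge = of_bool (d = 1)"
    by (subst expected_reward_step) (auto simp: out out_degree_def, simp_all add: single_edge_def)
  then show ?thesis by (simp add: mean_visits_def)
qed

text \<open>All networks in the support have exactly \<open>n\<close> arcs, so the uniform choice of
  \<open>e\<close> divides by the same \<open>n\<close> for each; the rest is linearity.\<close>

lemma mean_visits_Suc:
  assumes b: "b \<ge> 1" and n: "n \<ge> 1" and d: "1 \<le> d" "d \<le> b"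
  shows "mean_visits b (Suc n) d = mean_visits b n d +
    (real (d - 1) * mean_visits b n (d - 1) - (if d < b then real d * mean_visits b n d else 0)
      + (if d = 1 then mean_visits b n b else 0)) / real n"
proof -
  let ?N = "random_network b n"
  obtain m where m: "n = Suc m" using n by (cases n) auto
  have N: "random_network b (Suc n) =
      bind_pmf ?N (\<lambda>G. bind_pmf (pmf_of_set (arcs G)) (\<lambda>e. return_pmf (grow b G e)))"
    unfolding m by simp
  have bary: "bary_network b G" "card (arcs G) = n" "finite (arcs G)" "arcs G \<noteq> {}"
    if "G \<in> set_pmf ?N" for G
    using bary_network_random_network[OF b n that]
    by (auto simp: bary_network_def proper_network_def fin_digraph.finite_arcs)
  have "mean_visits b (Suc n) d = (\<Sum>G\<in>set_pmf ?N. pmf ?N G *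
      ((\<Sum>e\<in>arcs G. expected_visits d (grow b G e)) / real n))"
    unfolding mean_visits_def N
    by (subst pmf_expectation_bind[OF finite_set_random_network])
      (auto simp: bary pmf_expectation_bind_pmf_of_set divide_inverse sum_distrib_left mult_ac intro!: sum.cong)
  also have "\<dots> = (\<Sum>G\<in>set_pmf ?N. pmf ?N G * (expected_visits d G +
      (real (d - 1) * expected_visits (d - 1) G - (if d < b then real d * expected_visits d G else 0)
      + (if d = 1 then expected_visits b G else 0)) / real n))"
    using n by (intro sum.cong) (auto simp: sum_expected_visits_grow[OF _ b d] bary add_divide_distrib)
  also have "\<dots> = mean_visits b n d +
    (real (d - 1) * mean_visits b n (d - 1) - (if d < b then real d * mean_visits b n d else 0)
      + (if d = 1 then mean_visits b n b else 0)) / real n"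
    unfolding mean_visits_eq_sum
    by (cases "d < b"; cases "d = 1")
      (simp_all add: sum_distrib_left sum_divide_distrib sum.distrib sum_subtractf
        algebra_simps add_divide_distrib diff_divide_distrib)
  finally show ?thesis .
qed

text \<open>Each arc of the path is counted at its tail. The tail is not the sink, hence has an
  outgoing arc, and its out-degree lies between 1 and \<open>b\<close>.\<close>

lemma expected_path_length_eq_sum:
  assumes b: "b \<ge> 1" and n: "n \<ge> 1"
  shows "expected_path_length b n = (\<Sum>d=1..b. mean_visits b n d)"
proof -
  let ?N = "random_network b n"
  have length: "(\<integral>l. real l \<partial>measure_spmf (map_spmf length (random_path G source))) =
      (\<Sum>d=1..b. expected_visits d G)" if G: "G \<in> set_pmf ?N" for G
  proof -
    have bary: "bary_network b G" using bary_network_random_network[OF b n G] by blast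
    note proper = bary_networkD(1)[OF bary] and deg = bary_networkD(2)[OF bary]
    note fin = proper_networkD(2)[OF proper]
    have "(\<integral>l. real l \<partial>measure_spmf (map_spmf length (random_path G source))) =
        expected_reward G (\<lambda>_. 1) source"
      by (simp add: expected_reward_def measure_map_spmf_conv_distr integral_distr sum_list_triv)
    also have "\<dots> = expected_reward G (\<lambda>v. \<Sum>d=1..b. of_bool (out_degree G v = d)) source"
    proof (rule expected_reward_cong[OF proper proper_networkD(3)[OF proper]])
      fix v assume "v \<in> verts G" "v \<noteq> sink"
      then have "out_arcs G v \<noteq> {}"
        using proper_networkD(4)[OF proper] by (metis leads_to_sink.cases)
      then have "1 \<le> out_degree G v"
        using fin by (simp add: out_degree_def card_gt_0_iff finite_out_arcs Suc_le_eq)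
      then show "1 = (\<Sum>d=1..b. of_bool (out_degree G v = d) :: real)"
        using deg[of v] by (simp add: of_bool_def)
    qed
    also have "\<dots> = (\<Sum>d=1..b. expected_visits d G)"
      using proper_networkD[OF proper] by (intro expected_reward_sum) auto
    finally show ?thesis .
  qed
  have finite_paths: "finite (set_spmf (random_path G source))" if "G \<in> set_pmf ?N" for G
    using proper_networkD[OF proper_network_random_network[OF that]]
    by (intro finite_set_random_path) auto
  have "expected_path_length b n = (\<integral>G. (\<integral>l. real l \<partial>measure_spmf (map_spmf length (random_path G source)))
      \<partial>measure_spmf (spmf_of_pmf ?N))"
    unfolding expected_path_length_def path_length_def
    using finite_paths by (subst integral_bind_spmf_finite) (auto simp: finite_set_random_network)
  also have "\<dots> = (\<Sum>G\<in>set_pmf ?N. pmf ?N G * (\<Sum>d=1..b. expected_visits d G))"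
    by (subst integral_measure_spmf_finite[OF finite_set_random_network[of b n]]) (auto simp: length)
  also have "\<dots> = (\<Sum>d=1..b. mean_visits b n d)"
    unfolding mean_visits_eq_sum sum_distrib_left by (rule sum.swap)
  finally show ?thesis .
qed

theorem theorem10:
  fixes b :: nat
  assumes "b \<ge> 2"
  shows "card (char_roots b) = b \<and>
    (\<exists>!x :: real. x > 0 \<and> complex_of_real x \<in> char_roots b) \<and>
    (\<forall>(lam :: nat \<Rightarrow> complex) (l1 :: real).
       bij_betw lam {1..b} (char_roots b) \<and> lam 1 = complex_of_real l1 \<and> l1 > 0 \<longrightarrow>
       l1 < 1 \<and>
       (\<forall>n\<ge>1. complex_of_real (expected_path_length b n) =
          (\<Sum>i=1..b. 1 / (1 + lam i * harm_diff (lam i) (b - 1)) *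
             ((of_nat n + lam i - 1) gchoose (n - 1)))) \<and>
       (\<lambda>n. expected_path_length b n) \<sim>[at_top]
         (\<lambda>n. 1 / (1 + l1 * harm_diff l1 (b - 1)) * (real n powr l1 / Gamma (l1 + 1))))"
proof (intro conjI allI impI)
  show "card (char_roots b) = b" by (rule card_char_roots[OF assms])
  show "\<exists>!x :: real. x > 0 \<and> complex_of_real x \<in> char_roots b"
    by (rule positive_char_root_unique[OF assms])
next
  fix lam :: "nat \<Rightarrow> complex" and l1 :: real
  assume lam: "bij_betw lam {1..b} (char_roots b) \<and> lam 1 = complex_of_real l1 \<and> l1 > 0"
  then have l1: "complex_of_real l1 \<in> char_roots b" "l1 > 0"
    using assms bij_betwE[of lam "{1..b}" "char_roots b"] by force+
  have exact: "complex_of_real (expected_path_length b n) =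
      (\<Sum>x\<in>char_roots b. root_weight b x * ((of_nat n + x - 1) gchoose (n - 1)))" if "n \<ge> 1" for n
    unfolding expected_path_length_eq_sum[OF order.trans[OF one_le_numeral assms] that]
    using assms that by (intro linear_recurrence_solution mean_visits_1 mean_visits_Suc) auto
  show "l1 < 1" by (rule positive_char_root_less_1[OF assms l1(1)])
  show "(\<lambda>n. expected_path_length b n) \<sim>[at_top]
      (\<lambda>n. root_weight b l1 * (real n powr l1 / Gamma (l1 + 1)))"
    by (rule asymp_equiv_sum_gbinomial[OF assms exact l1])
  fix n :: nat assume "n \<ge> 1"
  moreover have "bij_betw lam {1..b} (char_roots b)" using lam by blast
  ultimately show "complex_of_real (expected_path_length b n) =
      (\<Sum>i=1..b. root_weight b (lam i) * ((of_nat n + lam i - 1) gchoose (n - 1)))"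
    unfolding exact[OF \<open>n \<ge> 1\<close>] by (intro sum.reindex_bij_betw[symmetric])
qed

end
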